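(* Let $(D,\mu),(E,\nu)\in\mathbf{DistNP}$ and let $f$ be a CS-reduction from $(D,\mu)$ to $(E,\nu)$. If the size growth $\mathcal{S}_f$ is bounded by a polynomial, then $f$ is both a GPtime reduction and an SGPtime reduction.
   Context: Decision problems $D=(\Sigma^\ast,D^+)$ with $\Sigma$ finite; spherical ensembles $\mu=\{\mu_n\}$ of probability functions on $\Sigma^n$; $\mu^\ast_{|x|}(x)=\mu_{|x|}(\{y\in\Sigma^{|x|}:y<_{lex}x\})$; $\mathbf{DistNP}$: $(D,\mu)$ with $D\in\mathbf{NP}$ and $x\mapsto\mu^\ast_{|x|}(x)$ Ptime computable (approximable within $2^{-k}$ in time polynomial in $|x|,k$). A TM $M$ partially decides $D$ if on each input it does not halt, halts with DontKnow, or halts with the correct Yes/No; $T_M(x)$ = steps to a Yes/No halt, else $\infty$. $M$ GPtime decides $(D,\mu)$ if it partially decides $D$ and for some polynomial $p$, $\mu_n\{x\in\Sigma^n:T_M(x)>p(n)\}=o(1)$; SGPtime decides if moreover this is $o(1/q(n))$ for every polynomial $q$. A Ptime reduction $f:\Sigma_D^\ast\to\Sigma_E^\ast$ is polynomial-time computable with $x\in D^+\iff f(x)\in E^+$; size-invariant: $|x_1|<|x_2|\iff|f(x_1)|<|f(x_2)|$; then $\mathcal{S}_f(n)=|f(x)|$ for $|x|=n$ is well defined (size growth). For $(D,\mu),(E,\nu)\in\mathbf{DistNP}$ a size-invariant Ptime reduction $f$ is a GPtime [SGPtime] reduction if for every TM $M$ that GPtime [SGPtime] decides $(E,\nu)$,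 $M\circ f$ (compute $f$ then run $M$) GPtime [SGPtime] decides $(D,\mu)$. $\nu$ is the $f$-transfer of $\mu$ if for every $y\in\Sigma_E^\ast$: $\nu_{|y|}(y)=\sum_{x\in f^{-1}(y)}\mu_{|x|}(x)$ when $|y|=|f(z)|$ for some $z$, and $\nu_{|y|}(y)=|\Sigma_E|^{-|y|}$ otherwise. A CS-reduction is a size-invariant Ptime reduction $f$ from $D$ to $E$ such that $\nu$ is the $f$-transfer of $\mu$. *)

theory Defs
  imports
    "HOL-Probability.Probability"
    "HOL-Library.Landau_Symbols"
    "HOL-Library.Extended_Nat"
    "HOL-Computational_Algebra.Polynomial"
begin

section \<open>Turing machines\<close>

text \<open>
  Deterministic single-tape machines with a two-way infinite tape. Tape symbols are drawn from one
  universe: the blank, the letters of the input alphabets (of type 's), and auxiliary marks; each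
  machine uses a finite set of them. A machine halts by entering one of three halting states.
\<close>

datatype 's cell = Blank | Letter 's | Mark nat

datatype verdict = Yes | No | DontKnow

datatype state = Work nat | Halt verdict

datatype move = GoLeft | Stay | GoRight

record 's tm =
  nstates :: nat
  symbols :: "'s cell set"
  delta :: "nat \<Rightarrow> 's cell \<Rightarrow> state \<times> 's cell \<times> move"

text \<open>The working states are those numbered below \<open>nstates\<close>; the initial one is \<open>Work 0\<close>.\<close>

definition is_tm :: "'s tm \<Rightarrow> bool" where
  "is_tm M \<longleftrightarrow>
     0 < nstates M \<and> finite (symbols M) \<and> Blank \<in> symbols M \<and>
     (\<forall>q<nstates M. \<forall>a\<in>symbols M. \<forall>s b d. delta M q a = (s, b, d) \<longrightarrow>
        b \<in> symbols M \<and> (\<forall>q'. s = Work q' \<longrightarrow> q' < nstates M))"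

definition tm_over :: "'s set \<Rightarrow> 's tm \<Rightarrow> bool" where
  "tm_over \<Sigma> M \<longleftrightarrow> is_tm M \<and> Letter ` \<Sigma> \<subseteq> symbols M"

text \<open>
  The tape is indexed relative to the head: the scanned cell is always cell 0, and moving the head
  to the right shifts the tape contents to the left.
\<close>

type_synonym 's config = "state \<times> (int \<Rightarrow> 's cell)"

fun shift_tape :: "move \<Rightarrow> (int \<Rightarrow> 's cell) \<Rightarrow> int \<Rightarrow> 's cell" where
  "shift_tape GoLeft t = (\<lambda>i. t (i - 1))"
| "shift_tape Stay t = t"
| "shift_tape GoRight t = (\<lambda>i. t (i + 1))"

fun step :: "'s tm \<Rightarrow> 's config \<Rightarrow> 's config" where
  "step M (Halt v, t) = (Halt v, t)"
| "step M (Work q, t) = (case delta M q (t 0) of (s, b, d) \<Rightarrow> (s, shift_tape d (t(0 := b))))"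

definition tape_of :: "'s cell list \<Rightarrow> int \<Rightarrow> 's cell" where
  "tape_of w i = (if 0 \<le> i \<and> i < int (length w) then w ! nat i else Blank)"

definition run :: "'s tm \<Rightarrow> nat \<Rightarrow> 's cell list \<Rightarrow> 's config" where
  "run M n w = (step M ^^ n) (Work 0, tape_of w)"

definition halts_with :: "'s tm \<Rightarrow> 's cell list \<Rightarrow> verdict \<Rightarrow> bool" where
  "halts_with M w v \<longleftrightarrow> (\<exists>n. fst (run M n w) = Halt v)"

text \<open>The number of steps up to a halt with answer Yes or No; infinite in all other cases.\<close>

definition time :: "'s tm \<Rightarrow> 's cell list \<Rightarrow> enat" where
  "time M w =
     (if halts_with M w Yes \<or> halts_with M w No
      then enat (LEAST n. fst (run M n w) \<in> {Halt Yes, Halt No}) else \<infinity>)"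

text \<open>
  A machine outputs the word \<open>w\<close> if it halts (in any halting state) with exactly \<open>w\<close> on its tape
  and the head on the first symbol of \<open>w\<close>.
\<close>

definition outputs_within :: "'s tm \<Rightarrow> 's cell list \<Rightarrow> nat \<Rightarrow> 's cell list \<Rightarrow> bool" where
  "outputs_within F u t w \<longleftrightarrow> (\<exists>n\<le>t. \<exists>v. run F n u = (Halt v, tape_of w))"

text \<open>
  First run \<open>F\<close>, then run \<open>M\<close> on the output of \<open>F\<close>: the working states of \<open>M\<close> are renumbered to
  follow those of \<open>F\<close>, and every halting transition of \<open>F\<close> leads to the initial state of \<open>M\<close>.
  The transitions to \<open>DontKnow\<close> only make the table total on the joint tape alphabet; they concern
  symbols that the respective component does not have.
\<close>

definition tm_comp :: "'s tm \<Rightarrow> 's tm \<Rightarrow> 's tm" where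
  "tm_comp M F =
     \<lparr> nstates = nstates F + nstates M,
       symbols = symbols F \<union> symbols M,
       delta = (\<lambda>q a.
         if q < nstates F then
           if a \<in> symbols F then
             (case delta F q a of
                (Work q', b, d) \<Rightarrow> (Work q', b, d)
              | (Halt v, b, d) \<Rightarrow> (Work (nstates F), b, d))
           else (Halt DontKnow, a, Stay)
         else
           if a \<in> symbols M then
             (case delta M (q - nstates F) a of
                (Work q', b, d) \<Rightarrow> (Work (nstates F + q'), b, d)
              | (Halt v, b, d) \<Rightarrow> (Halt v, b, d))
           else (Halt DontKnow, a, Stay)) \<rparr>"


section \<open>Decision problems and NP\<close>

definition words :: "'s set \<Rightarrow> nat \<Rightarrow> 's list set" where
  "words \<Sigma> n = {x \<in> lists \<Sigma>. length x = n}"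

record 's problem =
  alphabet :: "'s set"
  yes_set :: "'s list set"

definition decision_problem :: "'s problem \<Rightarrow> bool" where
  "decision_problem D \<longleftrightarrow> finite (alphabet D) \<and> yes_set D \<subseteq> lists (alphabet D)"

definition bits :: "bool list \<Rightarrow> 's cell list" where
  "bits = map (\<lambda>b. Mark (of_bool b))"

text \<open>
  NP via verifiers. \<open>Mark 2\<close> separates the instance from the certificate, a word over
  \<open>{Mark 0, Mark 1}\<close>. All polynomial bounds are polynomials with natural number coefficients.
\<close>

definition in_NP :: "'s problem \<Rightarrow> bool" where
  "in_NP D \<longleftrightarrow> decision_problem D \<and>
     (\<exists>V p t. tm_over (alphabet D) V \<and> {Mark 0, Mark 1, Mark 2} \<subseteq> symbols V \<and>
        (\<forall>x\<in>lists (alphabet D). \<forall>c.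
           time V (map Letter x @ Mark 2 # bits c) \<le> enat (poly t (length x + length c))) \<and>
        (\<forall>x\<in>lists (alphabet D). x \<in> yes_set D \<longleftrightarrow>
           (\<exists>c. length c \<le> poly p (length x) \<and>
                halts_with V (map Letter x @ Mark 2 # bits c) Yes)))"


section \<open>Distributional problems\<close>

definition spherical_ensemble :: "'s set \<Rightarrow> (nat \<Rightarrow> 's list pmf) \<Rightarrow> bool" where
  "spherical_ensemble \<Sigma> \<mu> \<longleftrightarrow> (\<forall>n. set_pmf (\<mu> n) \<subseteq> words \<Sigma> n)"

definition lex_cumulative :: "'s::linorder set \<Rightarrow> (nat \<Rightarrow> 's list pmf) \<Rightarrow> 's list \<Rightarrow> real" where
  "lex_cumulative \<Sigma> \<mu> x =
     measure_pmf.prob (\<mu> (length x))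
       {y \<in> words \<Sigma> (length x). (y, x) \<in> lexord {(a, b). a < b}}"

text \<open>The real number with binary expansion \<open>b\<^sub>0.b\<^sub>1b\<^sub>2\<dots>b\<^sub>m\<close>.\<close>

definition dyadic :: "bool list \<Rightarrow> real" where
  "dyadic bs = (\<Sum>i<length bs. of_bool (bs ! i) / 2 ^ i)"

text \<open>
  Polynomial-time computability of a function into the unit interval: given \<open>x\<close> and the precision
  \<open>k\<close> in unary, a dyadic approximation with error at most \<open>2\<^sup>-\<^sup>k\<close> is computed.
\<close>

definition ptime_real_function :: "'s set \<Rightarrow> ('s list \<Rightarrow> real) \<Rightarrow> bool" where
  "ptime_real_function \<Sigma> g \<longleftrightarrow>
     (\<exists>F p. tm_over \<Sigma> F \<and> {Mark 0, Mark 1} \<subseteq> symbols F \<and>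
        (\<forall>x\<in>lists \<Sigma>. \<forall>k. \<exists>bs.
           outputs_within F (map Letter x @ Mark 0 # replicate k (Mark 1))
             (poly p (length x + k)) (bits bs) \<and>
           \<bar>dyadic bs - g x\<bar> \<le> 1 / 2 ^ k))"

definition DistNP :: "('s::linorder problem \<times> (nat \<Rightarrow> 's list pmf)) set" where
  "DistNP = {(D, \<mu>). in_NP D \<and> spherical_ensemble (alphabet D) \<mu> \<and>
                     ptime_real_function (alphabet D) (lex_cumulative (alphabet D) \<mu>)}"

definition partially_decides :: "'s tm \<Rightarrow> 's problem \<Rightarrow> bool" where
  "partially_decides M D \<longleftrightarrow> tm_over (alphabet D) M \<and>
     (\<forall>x\<in>lists (alphabet D).
        (\<nexists>v. halts_with M (map Letter x) v) \<or>
        halts_with M (map Letter x) DontKnow \<or>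
        halts_with M (map Letter x) (if x \<in> yes_set D then Yes else No))"

definition late_prob :: "'s tm \<Rightarrow> 's problem \<times> (nat \<Rightarrow> 's list pmf) \<Rightarrow> nat poly \<Rightarrow> nat \<Rightarrow> real" where
  "late_prob M = (\<lambda>(D, \<mu>) p n.
     measure_pmf.prob (\<mu> n)
       {x \<in> words (alphabet D) n. time M (map Letter x) > enat (poly p n)})"

definition GPtime_decides :: "'s tm \<Rightarrow> 's problem \<times> (nat \<Rightarrow> 's list pmf) \<Rightarrow> bool" where
  "GPtime_decides M P \<longleftrightarrow>
     partially_decides M (fst P) \<and> (\<exists>p. late_prob M P p \<in> o(\<lambda>n. 1))"

text \<open>The zero polynomial is excluded because \<open>1 / q(n)\<close> is meaningless for it.\<close>

definition SGPtime_decides :: "'s tm \<Rightarrow> 's problem \<times> (nat \<Rightarrow> 's list pmf) \<Rightarrow> bool" where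
  "SGPtime_decides M P \<longleftrightarrow>
     partially_decides M (fst P) \<and>
     (\<exists>p. late_prob M P p \<in> o(\<lambda>n. 1) \<and>
          (\<forall>q::nat poly. q \<noteq> 0 \<longrightarrow> late_prob M P p \<in> o(\<lambda>n. 1 / real (poly q n))))"


section \<open>Reductions\<close>

definition ptime_computes :: "'s tm \<Rightarrow> 's set \<Rightarrow> ('s list \<Rightarrow> 's list) \<Rightarrow> bool" where
  "ptime_computes F \<Sigma> f \<longleftrightarrow> tm_over \<Sigma> F \<and>
     (\<exists>p. \<forall>x\<in>lists \<Sigma>.
        outputs_within F (map Letter x) (poly p (length x)) (map Letter (f x)))"

definition ptime_reduction :: "'s problem \<Rightarrow> 's problem \<Rightarrow> ('s list \<Rightarrow> 's list) \<Rightarrow> bool" where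
  "ptime_reduction D E f \<longleftrightarrow>
     f \<in> lists (alphabet D) \<rightarrow> lists (alphabet E) \<and>
     (\<exists>F. ptime_computes F (alphabet D) f) \<and>
     (\<forall>x\<in>lists (alphabet D). x \<in> yes_set D \<longleftrightarrow> f x \<in> yes_set E)"

definition size_invariant :: "'s problem \<Rightarrow> ('s list \<Rightarrow> 's list) \<Rightarrow> bool" where
  "size_invariant D f \<longleftrightarrow>
     (\<forall>x1\<in>lists (alphabet D). \<forall>x2\<in>lists (alphabet D).
        length x1 < length x2 \<longleftrightarrow> length (f x1) < length (f x2))"

text \<open>Well defined if \<open>f\<close> is size-invariant and the alphabet of \<open>D\<close> is nonempty.\<close>

definition size_growth :: "'s problem \<Rightarrow> ('s list \<Rightarrow> 's list) \<Rightarrow> nat \<Rightarrow> nat" where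
  "size_growth D f n = (THE m. \<forall>x\<in>words (alphabet D) n. length (f x) = m)"

text \<open>
  The composite of \<open>f\<close> and \<open>M\<close> is formed with any polynomial-time machine \<open>F\<close> computing \<open>f\<close>.
\<close>

definition GPtime_reduction ::
  "'s problem \<times> (nat \<Rightarrow> 's list pmf) \<Rightarrow> 's problem \<times> (nat \<Rightarrow> 's list pmf) \<Rightarrow>
   ('s list \<Rightarrow> 's list) \<Rightarrow> bool" where
  "GPtime_reduction P Q f \<longleftrightarrow>
     ptime_reduction (fst P) (fst Q) f \<and> size_invariant (fst P) f \<and>
     (\<forall>M F. GPtime_decides M Q \<and> ptime_computes F (alphabet (fst P)) f \<longrightarrow>
        GPtime_decides (tm_comp M F) P)"

definition SGPtime_reduction ::
  "'s problem \<times> (nat \<Rightarrow> 's list pmf) \<Rightarrow> 's problem \<times> (nat \<Rightarrow> 's list pmf) \<Rightarrow>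
   ('s list \<Rightarrow> 's list) \<Rightarrow> bool" where
  "SGPtime_reduction P Q f \<longleftrightarrow>
     ptime_reduction (fst P) (fst Q) f \<and> size_invariant (fst P) f \<and>
     (\<forall>M F. SGPtime_decides M Q \<and> ptime_computes F (alphabet (fst P)) f \<longrightarrow>
        SGPtime_decides (tm_comp M F) P)"

text \<open>The sum is finite when \<open>f\<close> is size-invariant: all preimages of \<open>y\<close> have the same length.\<close>

definition is_transfer ::
  "'s problem \<Rightarrow> (nat \<Rightarrow> 's list pmf) \<Rightarrow> 's problem \<Rightarrow> (nat \<Rightarrow> 's list pmf) \<Rightarrow>
   ('s list \<Rightarrow> 's list) \<Rightarrow> bool" where
  "is_transfer D \<mu> E \<nu> f \<longleftrightarrow>
     (\<forall>y\<in>lists (alphabet E).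
        pmf (\<nu> (length y)) y =
          (if \<exists>z\<in>lists (alphabet D). length y = length (f z)
           then \<Sum>x\<in>{x \<in> lists (alphabet D). f x = y}. pmf (\<mu> (length x)) x
           else 1 / real (card (alphabet E)) ^ length y))"

definition CS_reduction ::
  "'s problem \<times> (nat \<Rightarrow> 's list pmf) \<Rightarrow> 's problem \<times> (nat \<Rightarrow> 's list pmf) \<Rightarrow>
   ('s list \<Rightarrow> 's list) \<Rightarrow> bool" where
  "CS_reduction = (\<lambda>(D, \<mu>) (E, \<nu>) f.
     ptime_reduction D E f \<and> size_invariant D f \<and> is_transfer D \<mu> E \<nu> f)"

end

theory Submission
  imports Defs
begin

text \<open>
  The transfer condition says that \<open>\<nu>\<close> at size \<open>\<S>\<^sub>f n\<close> is the push-forward of \<open>\<mu> n\<close> along \<open>f\<close>. A late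
  input \<open>x\<close> of the composite machine therefore comes from a late input \<open>f x\<close> of \<open>M\<close>, with at most the
  same probability, as soon as the time bound absorbs the cost of computing \<open>f\<close> and the polynomial
  growth of the size. Since \<open>\<S>\<^sub>f\<close> is strictly increasing, \<open>n \<le> \<S>\<^sub>f n\<close>, so decay at size \<open>\<S>\<^sub>f n\<close> is at
  least as good as decay at size \<open>n\<close>.
\<close>

section \<open>Runs of composite machines\<close>

text \<open>In \<open>tm_comp\<close>, a component meeting a symbol outside its own alphabet falls
  into the \<open>DontKnow\<close> default. This invariant keeps each phase away from that default:
  every tape symbol and every working state belongs to the component.\<close>

definition wf_config :: "'s tm \<Rightarrow> 's config \<Rightarrow> bool" where
  "wf_config M c \<longleftrightarrow> range (snd c) \<subseteq> symbols M \<and> (\<forall>q. fst c = Work q \<longrightarrow> q < nstates M)"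

lemma range_shift_tape: "range (shift_tape d t) \<subseteq> range t"
  by (cases d) auto

lemma wf_config_step:
  assumes "is_tm M" and "wf_config M c"
  shows "wf_config M (step M c)"
proof (cases c)
  case (Pair s t)
  show ?thesis
  proof (cases s)
    case (Work q)
    obtain s' b d where tr: "delta M q (t 0) = (s', b, d)"
      by (metis prod_cases3)
    have q: "q < nstates M" and t: "range t \<subseteq> symbols M"
      using assms(2) Pair Work by (auto simp: wf_config_def)
    from t have "t 0 \<in> symbols M" by auto
    with assms(1) q tr have b: "b \<in> symbols M" and s': "\<forall>q'. s' = Work q' \<longrightarrow> q' < nstates M"
      unfolding is_tm_def by blast+
    have "range (shift_tape d (t(0 := b))) \<subseteq> symbols M"
      using subset_trans[OF range_shift_tape, of "t(0 := b)" "symbols M" d] t b by auto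
    with s' show ?thesis by (simp add: Pair Work tr wf_config_def)
  next
    case (Halt v)
    with assms(2) Pair show ?thesis by simp
  qed
qed

lemma wf_config_init:
  assumes "is_tm M" and "set w \<subseteq> symbols M"
  shows "wf_config M (Work 0, tape_of w)"
proof -
  have "tape_of w i \<in> symbols M" for i
  proof (cases "0 \<le> i \<and> i < int (length w)")
    case True
    then have "w ! nat i \<in> set w" by (intro nth_mem) auto
    with True assms(2) show ?thesis by (auto simp: tape_of_def)
  qed (use assms(1) in \<open>auto simp: tape_of_def is_tm_def\<close>)
  with assms(1) show ?thesis by (auto simp: wf_config_def is_tm_def)
qed

lemma run_0: "run M 0 w = (Work 0, tape_of w)"
  by (simp add: run_def)

lemma run_Suc: "run M (Suc n) w = step M (run M n w)"
  by (simp add: run_def)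

lemma wf_config_run:
  assumes "is_tm M" and "set w \<subseteq> symbols M"
  shows "wf_config M (run M n w)"
  by (induction n) (simp_all add: run_0 run_Suc wf_config_init wf_config_step assms)

lemma run_halted:
  assumes "run M m w = (Halt v, t)" and "m \<le> n"
  shows "run M n w = (Halt v, t)"
  using assms(2) by (induction n rule: dec_induct) (simp_all add: assms(1) run_Suc)

text \<open>The handover is built in: the verdict of \<open>F\<close> is dropped and replaced by the
  renumbered initial state of \<open>M\<close>. Because tapes are indexed relative to the head, the
  tape left by \<open>F\<close> is literally an initial tape for \<open>M\<close>.\<close>

fun first_config :: "'s tm \<Rightarrow> 's config \<Rightarrow> 's config" where
  "first_config F (Work q, t) = (Work q, t)"
| "first_config F (Halt v, t) = (Work (nstates F), t)"

fun second_config :: "'s tm \<Rightarrow> 's config \<Rightarrow> 's config" where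
  "second_config F (Work q, t) = (Work (nstates F + q), t)"
| "second_config F (Halt v, t) = (Halt v, t)"

text \<open>The restriction to working states matters: once \<open>F\<close> has halted,
  \<open>step F\<close> stands still, whereas the composite goes on with \<open>M\<close>.\<close>

lemma step_first_config:
  assumes "wf_config F (Work q, t)"
  shows "step (tm_comp M F) (first_config F (Work q, t)) = first_config F (step F (Work q, t))"
proof -
  have "q < nstates F" "t 0 \<in> symbols F"
    using assms by (auto simp: wf_config_def)
  then show ?thesis
    by (auto simp: tm_comp_def split: prod.split state.split)
qed

text \<open>Halted configurations are included, since both machines are stationary there; in a
  working state the offset \<open>nstates F\<close> cancels in the transition table.\<close>

lemma step_second_config:
  assumes "wf_config M c"
  shows "step (tm_comp M F) (second_config F c) = second_config F (step M c)"
proof (cases c)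
  case (Pair s t)
  then have "t 0 \<in> symbols M"
    using assms by (auto simp: wf_config_def)
  with Pair show ?thesis
    by (cases s) (auto simp: tm_comp_def split: prod.split state.split)
qed

lemma fst_second_config_eq_Halt: "fst (second_config F c) = Halt v \<longleftrightarrow> fst c = Halt v"
  by (cases "(F, c)" rule: second_config.cases) auto

lemma is_tm_comp:
  assumes "is_tm F" and "is_tm M"
  shows "is_tm (tm_comp M F)"
  unfolding is_tm_def
proof (intro conjI allI impI ballI)
  fix q a s b d
  assume q: "q < nstates (tm_comp M F)" and tr: "delta (tm_comp M F) q a = (s, b, d)"
    and a: "a \<in> symbols (tm_comp M F)"
  have F: "b \<in> symbols F \<and> (\<forall>q'. s = Work q' \<longrightarrow> q' < nstates F)"
    if "p < nstates F" "a \<in> symbols F" "delta F p a = (s, b, d)" for p s b d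
    using assms(1) that unfolding is_tm_def by blast
  have M: "b \<in> symbols M \<and> (\<forall>q'. s = Work q' \<longrightarrow> q' < nstates M)"
    if "p < nstates M" "a \<in> symbols M" "delta M p a = (s, b, d)" for p s b d
    using assms(2) that unfolding is_tm_def by blast
  have pos: "0 < nstates M" using assms(2) by (simp add: is_tm_def)
  have q': "q - nstates F < nstates M" if "\<not> q < nstates F"
    using q that by (auto simp: tm_comp_def)
  show "b \<in> symbols (tm_comp M F)"
    using tr a q' by (auto simp: tm_comp_def split: if_splits prod.splits state.splits dest: F M)
  show "p < nstates (tm_comp M F)" if "s = Work p" for p
    using tr q' pos that
    by (auto simp: tm_comp_def split: if_splits prod.splits state.splits dest: F M)
qed (use assms in \<open>auto simp: is_tm_def tm_comp_def\<close>)

text \<open>Halting is excluded only strictly before time \<open>n\<close>, so \<open>n\<close> may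
  be the first halting time of \<open>F\<close>; there the right-hand side is already the start of
  \<open>M\<close>.\<close>

lemma run_first_config:
  assumes "is_tm F" and "set u \<subseteq> symbols F"
    and "\<And>m v. m < n \<Longrightarrow> fst (run F m u) \<noteq> Halt v"
  shows "run (tm_comp M F) n u = first_config F (run F n u)"
  using assms(3)
proof (induction n)
  case 0
  then show ?case by (simp add: run_0)
next
  case (Suc n)
  obtain q t where c: "run F n u = (Work q, t)"
    using Suc.prems[of n] by (cases "run F n u"; cases "fst (run F n u)") auto
  have "wf_config F (Work q, t)"
    using wf_config_run[OF assms(1,2), of n] c by simp
  then show ?case
    using Suc c step_first_config[of F q t M] by (simp add: run_Suc del: step.simps)
qed

section \<open>Halting and running time of the composite on one input\<close>

locale tm_composition =
  fixes F M :: "'s tm" and u w :: "'s cell list" and T :: nat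
  assumes F: "is_tm F" and M: "is_tm M"
    and u: "set u \<subseteq> symbols F" and w: "set w \<subseteq> symbols M"
    and outputs: "outputs_within F u T w"
begin

lemma run_comp:
  obtains m where "m \<le> T"
    and "\<And>k. run (tm_comp M F) (m + k) u = second_config F (run M k w)"
proof -
  obtain n v where n: "n \<le> T" "run F n u = (Halt v, tape_of w)"
    using outputs by (auto simp: outputs_within_def)
  \<comment> \<open>The time \<open>n\<close> from \<open>outputs_within\<close> may lie beyond the
    actual halt of \<open>F\<close>, but the handover happens at the first halt. A halted
    configuration never changes, so the tape at time \<open>m\<close> is already the output.\<close>
  define m where "m = (LEAST m. \<exists>v. fst (run F m u) = Halt v)"
  have ex: "\<exists>v. fst (run F n u) = Halt v" using n by simp
  have "m \<le> n" unfolding m_def using ex by (rule Least_le)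
  have "\<exists>v. fst (run F m u) = Halt v" unfolding m_def using ex by (rule LeastI)
  then obtain v' t where "run F m u = (Halt v', t)" by (metis prod.collapse)
  with run_halted[OF this \<open>m \<le> n\<close>] n have m: "run F m u = (Halt v, tape_of w)" by simp
  have "fst (run F i u) \<noteq> Halt v" if "i < m" for i v
    using not_less_Least[of i "\<lambda>m. \<exists>v. fst (run F m u) = Halt v"] that by (auto simp: m_def)
  from run_first_config[OF F u this] m
  have start: "run (tm_comp M F) m u = (Work (nstates F), tape_of w)" by simp
  have "run (tm_comp M F) (m + k) u = second_config F (run M k w)" for k
    by (induction k)
      (simp_all add: run_0 run_Suc start step_second_config wf_config_run[OF M w])
  with \<open>m \<le> n\<close> n(1) show ?thesis by (intro that[of m]) auto
qed

lemma halts_with_comp: "halts_with (tm_comp M F) u v \<longleftrightarrow> halts_with M w v"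
proof -
  obtain m where m: "\<And>k. run (tm_comp M F) (m + k) u = second_config F (run M k w)"
    using run_comp by blast
  show ?thesis
  proof
    assume "halts_with (tm_comp M F) u v"
    then obtain n t where "run (tm_comp M F) n u = (Halt v, t)"
      unfolding halts_with_def by (metis prod.collapse)
    \<comment> \<open>The halt at time \<open>n\<close> persists to time \<open>m + n\<close>, which
      corresponds to time \<open>n\<close> of \<open>M\<close> whether or not \<open>n\<close>
      exceeds \<open>m\<close>.\<close>
    then have "fst (run (tm_comp M F) (m + n) u) = Halt v"
      using run_halted[of _ n u v t "m + n"] by simp
    then show "halts_with M w v"
      unfolding m fst_second_config_eq_Halt halts_with_def by blast
  next
    assume "halts_with M w v"
    then show "halts_with (tm_comp M F) u v"
      unfolding halts_with_def using m fst_second_config_eq_Halt by metis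
  qed
qed

lemma time_comp_le: "time (tm_comp M F) u \<le> enat T + time M w"
proof (cases "halts_with M w Yes \<or> halts_with M w No")
  case True
  obtain m where m: "m \<le> T" "\<And>k. run (tm_comp M F) (m + k) u = second_config F (run M k w)"
    using run_comp by blast
  define k where "k = (LEAST n. fst (run M n w) \<in> {Halt Yes, Halt No})"
  have "\<exists>n. fst (run M n w) \<in> {Halt Yes, Halt No}"
    using True by (auto simp: halts_with_def)
  then have "fst (run M k w) \<in> {Halt Yes, Halt No}"
    unfolding k_def by (rule LeastI_ex)
  then have "fst (run (tm_comp M F) (m + k) u) \<in> {Halt Yes, Halt No}"
    by (auto simp: m fst_second_config_eq_Halt)
  then have "(LEAST n. fst (run (tm_comp M F) n u) \<in> {Halt Yes, Halt No}) \<le> m + k"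
    by (rule Least_le)
  with m(1) True show ?thesis
    by (simp add: time_def halts_with_comp k_def)
next
  case False
  then show ?thesis by (simp add: time_def)
qed

end

section \<open>Size growth and transfer\<close>

lemma poly_nat_mono: "m \<le> n \<Longrightarrow> poly p m \<le> poly p n" for m n :: nat
  by (induction p) (auto intro!: add_mono mult_mono)

lemma poly_nat_pos:
  fixes p :: "nat poly"
  assumes "p \<noteq> 0" and "0 < n"
  shows "0 < poly p n"
  using assms by (induction p) auto

text \<open>Monotonicity of \<open>q\<close> turns growth of the argument into decay of the
  reciprocal. If \<open>q = 0\<close>, both functions vanish because division by zero gives
  zero.\<close>

lemma bigo_inverse_poly_compose:
  fixes q :: "nat poly"
  assumes "\<And>n. n \<le> g n"
  shows "(\<lambda>n. 1 / real (poly q (g n))) \<in> O(\<lambda>n. 1 / real (poly q n))"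
proof (cases "q = 0")
  case False
  show ?thesis
  \<comment> \<open>The point \<open>n = 0\<close> is left out: there \<open>poly q n\<close> may be
    zero, which makes the comparison function zero.\<close>
  proof (rule bigoI[where c = 1], rule eventually_mono[OF eventually_gt_at_top[of 0]])
    fix n :: nat
    assume "0 < n"
    then have "0 < poly q n" by (rule poly_nat_pos[OF False])
    with poly_nat_mono[OF assms, of q n]
    show "norm (1 / real (poly q (g n))) \<le> 1 * norm (1 / real (poly q n))"
      by (simp add: frac_le)
  qed
qed simp

section \<open>Lengths of images and the push-forward\<close>

lemma finite_words: "finite \<Sigma> \<Longrightarrow> finite (words \<Sigma> n)"
  using finite_lists_length_eq[of \<Sigma> n] by (simp add: words_def lists_eq_set)

text \<open>A probability distribution has nonempty support. This supplies a word of every length,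
  so that \<open>size_growth\<close> takes a meaningful value at every \<open>n\<close>.\<close>

lemma spherical_ensemble_words_ne: "spherical_ensemble \<Sigma> \<mu> \<Longrightarrow> words \<Sigma> n \<noteq> {}"
  using set_pmf_not_empty[of "\<mu> n"] by (force simp: spherical_ensemble_def)

locale cs_reduction =
  fixes D E :: "'s problem" and \<mu> \<nu> :: "nat \<Rightarrow> 's list pmf" and f :: "'s list \<Rightarrow> 's list"
  assumes finite_alphabet: "finite (alphabet D)"
    and \<mu>: "spherical_ensemble (alphabet D) \<mu>" and \<nu>: "spherical_ensemble (alphabet E) \<nu>"
    and CS: "CS_reduction (D, \<mu>) (E, \<nu>) f"
begin

lemma reduction: "ptime_reduction D E f"
  and invariant: "size_invariant D f"
  and transfer: "is_transfer D \<mu> E \<nu> f"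
  using CS by (auto simp: CS_reduction_def)

lemma f_in: "x \<in> lists (alphabet D) \<Longrightarrow> f x \<in> lists (alphabet E)"
  using reduction unfolding ptime_reduction_def by blast

lemma length_f_less_iff:
  assumes "x \<in> lists (alphabet D)" and "y \<in> lists (alphabet D)"
  shows "length (f x) < length (f y) \<longleftrightarrow> length x < length y"
  using invariant assms unfolding size_invariant_def by blast

lemma length_f_eq_iff:
  assumes "x \<in> lists (alphabet D)" and "y \<in> lists (alphabet D)"
  shows "length (f x) = length (f y) \<longleftrightarrow> length x = length y"
  using length_f_less_iff[OF assms] length_f_less_iff[OF assms(2,1)] by linarith

lemma length_f:
  assumes "x \<in> words (alphabet D) n"
  shows "length (f x) = size_growth D f n"
proof -
  have "\<forall>y\<in>words (alphabet D) n. length (f y) = length (f x)"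
    using assms length_f_eq_iff by (auto simp: words_def)
  with assms show ?thesis
    unfolding size_growth_def by (intro the_equality[symmetric]) (blast, metis)
qed

text \<open>Two consequences are used later: \<open>n \<le> size_growth D f n\<close>, for comparing
  decay rates, and divergence of the size growth, for substituting it into a little-o
  statement.\<close>

lemma strict_mono_size_growth: "strict_mono (size_growth D f)"
proof (rule strict_monoI)
  fix m n :: nat
  assume "m < n"
  obtain x y where "x \<in> words (alphabet D) m" "y \<in> words (alphabet D) n"
    using spherical_ensemble_words_ne[OF \<mu>] by blast
  with \<open>m < n\<close> length_f[of x m] length_f[of y n] length_f_less_iff[of x y]
  show "size_growth D f m < size_growth D f n" by (auto simp: words_def)
qed

text \<open>For \<open>y\<close> of length \<open>?m\<close>, size-invariance puts the whole fibre
  over \<open>y\<close> into words of length \<open>n\<close>, so the transfer sum is the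
  \<open>\<mu> n\<close>-mass of that fibre. For any other \<open>y\<close>, both sides vanish by
  their supports.\<close>

lemma transfer_eq_map_pmf: "\<nu> (size_growth D f n) = map_pmf f (\<mu> n)"
proof (rule pmf_eqI)
  fix y
  let ?m = "size_growth D f n"
  have supp: "set_pmf (\<mu> n) \<subseteq> words (alphabet D) n"
    and supp': "set_pmf (\<nu> ?m) \<subseteq> words (alphabet E) ?m"
    using \<mu> \<nu> by (auto simp: spherical_ensemble_def)
  show "pmf (\<nu> ?m) y = pmf (map_pmf f (\<mu> n)) y"
  proof (cases "y \<in> words (alphabet E) ?m")
    case True
    \<comment> \<open>This word selects the summation branch of the transfer condition and also
      fixes the length of all preimages of \<open>y\<close>.\<close>
    obtain z where z: "z \<in> words (alphabet D) n"
      using spherical_ensemble_words_ne[OF \<mu>] by blast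
    have z': "z \<in> lists (alphabet D)" "length z = n" "length (f z) = ?m"
      using z length_f[OF z] by (simp_all add: words_def)
    have y: "y \<in> lists (alphabet E)" "length y = ?m"
      using True by (auto simp: words_def)
    have fibre: "{x \<in> lists (alphabet D). f x = y} = {x \<in> words (alphabet D) n. f x = y}"
    proof (intro Collect_cong iffI conjI)
      fix x
      assume x: "x \<in> lists (alphabet D) \<and> f x = y"
      then have "length x = n"
        using length_f_eq_iff[of x z] z' y by simp
      with x show "x \<in> words (alphabet D) n" by (simp add: words_def)
    qed (simp_all add: words_def)
    have "\<exists>z\<in>lists (alphabet D). length y = length (f z)"
      using z' y by force
    with bspec[OF transfer[unfolded is_transfer_def] y(1)] y(2)
    have "pmf (\<nu> ?m) y = (\<Sum>x\<in>{x \<in> words (alphabet D) n. f x = y}. pmf (\<mu> (length x)) x)"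
      by (simp only: fibre if_True)
    also have "\<dots> = (\<Sum>x\<in>{x \<in> words (alphabet D) n. f x = y}. pmf (\<mu> n) x)"
      by (rule sum.cong) (auto simp: words_def)
    also have "\<dots> = measure_pmf.prob (\<mu> n) {x \<in> words (alphabet D) n. f x = y}"
      by (rule measure_measure_pmf_finite[symmetric]) (simp add: finite_words finite_alphabet)
    \<comment> \<open>The full preimage may contain lists that are not words of length
      \<open>n\<close>; these lie outside the support of \<open>\<mu> n\<close>.\<close>
    also have "\<dots> = measure_pmf.prob (\<mu> n) (f -` {y})"
      using supp by (intro measure_pmf.finite_measure_eq_AE) (auto simp: AE_measure_pmf_iff)
    finally show ?thesis by (simp add: pmf_map)
  next
    case False
    have "f ` set_pmf (\<mu> n) \<subseteq> words (alphabet E) ?m"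
    proof (intro image_subsetI)
      fix x
      assume "x \<in> set_pmf (\<mu> n)"
      with supp have x: "x \<in> words (alphabet D) n" by blast
      then show "f x \<in> words (alphabet E) ?m"
        using f_in[of x] length_f[OF x] by (simp add: words_def)
    qed
    with False supp' have "y \<notin> set_pmf (\<nu> ?m)" "y \<notin> set_pmf (map_pmf f (\<mu> n))"
      unfolding set_map_pmf by blast+
    then show ?thesis unfolding pmf_eq_0_set_pmf[symmetric] by simp
  qed
qed

end

section \<open>Composition with a reduction\<close>

locale cs_composition = cs_reduction D E \<mu> \<nu> f
  for D E :: "'s problem" and \<mu> \<nu> :: "nat \<Rightarrow> 's list pmf" and f :: "'s list \<Rightarrow> 's list" +
  fixes F M :: "'s tm"
  assumes computes: "ptime_computes F (alphabet D) f"
    and decides: "partially_decides M E"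
begin

lemma tm_composition_word:
  assumes "x \<in> lists (alphabet D)"
    and "outputs_within F (map Letter x) T (map Letter (f x))"
  shows "tm_composition F M (map Letter x) (map Letter (f x)) T"
proof
  have over: "tm_over (alphabet D) F" "tm_over (alphabet E) M"
    using computes decides by (auto simp: ptime_computes_def partially_decides_def)
  then show "is_tm F" "is_tm M" by (auto simp: tm_over_def)
  show "set (map Letter x) \<subseteq> symbols F" "set (map Letter (f x)) \<subseteq> symbols M"
    using over assms(1) f_in[OF assms(1)] unfolding tm_over_def lists_eq_set set_map by blast+
qed (fact assms(2))

lemma partially_decides_comp: "partially_decides (tm_comp M F) D"
  unfolding partially_decides_def
proof (intro conjI ballI)
  have "tm_over (alphabet D) F" "tm_over (alphabet E) M"
    using computes decides by (auto simp: ptime_computes_def partially_decides_def)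
  then show "tm_over (alphabet D) (tm_comp M F)"
    using is_tm_comp[of F M] by (auto simp: tm_over_def tm_comp_def)
next
  fix x
  assume x: "x \<in> lists (alphabet D)"
  obtain T where "outputs_within F (map Letter x) T (map Letter (f x))"
    using computes x by (auto simp: ptime_computes_def)
  then interpret tm_composition F M "map Letter x" "map Letter (f x)" T
    by (rule tm_composition_word[OF x])
  have "x \<in> yes_set D \<longleftrightarrow> f x \<in> yes_set E"
    using reduction x by (auto simp: ptime_reduction_def)
  then show "(\<nexists>v. halts_with (tm_comp M F) (map Letter x) v) \<or>
      halts_with (tm_comp M F) (map Letter x) DontKnow \<or>
      halts_with (tm_comp M F) (map Letter x) (if x \<in> yes_set D then Yes else No)"
    using decides f_in[OF x] unfolding partially_decides_def halts_with_comp by auto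
qed

text \<open>A late input of the composite is mapped by \<open>f\<close> to a late input of
  \<open>M\<close>, and the \<open>\<mu> n\<close>-mass of a preimage under \<open>f\<close> is the
  mass under the push-forward.\<close>

lemma late_prob_comp:
  assumes s: "\<And>n. size_growth D f n \<le> poly s n"
  obtains r where "\<And>n. late_prob (tm_comp M F) (D, \<mu>) r n \<le> late_prob M (E, \<nu>) p (size_growth D f n)"
proof -
  obtain c where c: "\<And>x. x \<in> lists (alphabet D) \<Longrightarrow>
      outputs_within F (map Letter x) (poly c (length x)) (map Letter (f x))"
    using computes by (auto simp: ptime_computes_def)
  \<comment> \<open>In the bound, \<open>c\<close> pays for computing \<open>f\<close>, and
    \<open>pcompose p s\<close> dominates \<open>p\<close> at the size growth because
    \<open>p\<close> is monotone.\<close>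
  have "late_prob (tm_comp M F) (D, \<mu>) (c + pcompose p s) n
          \<le> late_prob M (E, \<nu>) p (size_growth D f n)" for n
  proof -
    let ?m = "size_growth D f n"
    have "f x \<in> words (alphabet E) ?m \<and> time M (map Letter (f x)) > enat (poly p ?m)"
      if x: "x \<in> words (alphabet D) n"
        and late: "time (tm_comp M F) (map Letter x) > enat (poly (c + pcompose p s) n)" for x
    proof
      have x': "x \<in> lists (alphabet D)" "length x = n"
        using x by (auto simp: words_def)
      show "f x \<in> words (alphabet E) ?m"
        using f_in[OF x'(1)] length_f[OF x] by (simp add: words_def)
      interpret tm_composition F M "map Letter x" "map Letter (f x)" "poly c n"
        using tm_composition_word[OF x'(1) c[OF x'(1)]] x'(2) by simp
      have "enat (poly c n) + enat (poly p (poly s n)) < enat (poly c n) + time M (map Letter (f x))"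
        using less_le_trans[OF late time_comp_le] by (simp add: poly_pcompose)
      \<comment> \<open>Cancelling the summand is legitimate because it is finite; the case split
        covers an infinite running time of \<open>M\<close>.\<close>
      then have "enat (poly p (poly s n)) < time M (map Letter (f x))"
        by (cases "time M (map Letter (f x))") auto
      then show "enat (poly p ?m) < time M (map Letter (f x))"
        using poly_nat_mono[OF s, of p n] by (meson enat_ord_simps(1) le_less_trans)
    qed
    then have "{x \<in> words (alphabet D) n.
          enat (poly (c + pcompose p s) n) < time (tm_comp M F) (map Letter x)}
        \<subseteq> f -` {y \<in> words (alphabet E) ?m. enat (poly p ?m) < time M (map Letter y)}"
      by blast
    then show ?thesis
      by (simp add: late_prob_def transfer_eq_map_pmf measure_pmf.finite_measure_mono)
  qed
  then show ?thesis by (rule that)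
qed

end

text \<open>Little-o survives substitution of a sequence tending to infinity, which gives decay
  relative to \<open>g\<close> at the size growth. The last hypothesis compares this rate with
  \<open>g\<close> itself.\<close>

lemma (in cs_reduction) smallo_size_growth:
  assumes "\<And>n. late_prob M' (D, \<mu>) r n \<le> late_prob M (E, \<nu>) p (size_growth D f n)"
    and "late_prob M (E, \<nu>) p \<in> o(g)"
    and "(\<lambda>n. g (size_growth D f n)) \<in> O(g)"
  shows "late_prob M' (D, \<mu>) r \<in> o(g)"
proof -
  have "late_prob M' (D, \<mu>) r \<in> O(\<lambda>n. late_prob M (E, \<nu>) p (size_growth D f n))"
    by (rule bigoI[where c = 1]) (use assms(1) in \<open>auto simp: late_prob_def\<close>)
  also have "(\<lambda>n. late_prob M (E, \<nu>) p (size_growth D f n)) \<in> o(\<lambda>n. g (size_growth D f n))"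
    by (rule landau_o.small.compose[OF assms(2) filterlim_subseq[OF strict_mono_size_growth]])
  also note assms(3)
  finally show ?thesis .
qed

theorem theorem4p7:
  fixes D E :: "'s::linorder problem"
    and \<mu> \<nu> :: "nat \<Rightarrow> 's list pmf"
    and f :: "'s list \<Rightarrow> 's list"
  assumes "(D, \<mu>) \<in> DistNP" and "(E, \<nu>) \<in> DistNP"
    and "CS_reduction (D, \<mu>) (E, \<nu>) f"
    and "\<exists>p :: nat poly. \<forall>n. size_growth D f n \<le> poly p n"
  shows "GPtime_reduction (D, \<mu>) (E, \<nu>) f \<and> SGPtime_reduction (D, \<mu>) (E, \<nu>) f"
proof -
  interpret cs_reduction D E \<mu> \<nu> f
    using assms(1-3) by unfold_locales (auto simp: DistNP_def in_NP_def decision_problem_def)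
  obtain s where s: "\<And>n. size_growth D f n \<le> poly s n"
    using assms(4) by blast
  \<comment> \<open>The bound \<open>r\<close> is chosen before the rate \<open>g\<close>: SGPtime
    demands a single time bound that serves all polynomials \<open>q\<close> at once.\<close>
  have comp: "partially_decides (tm_comp M F) D \<and>
      (\<exists>r. \<forall>g. late_prob M (E, \<nu>) p \<in> o(g) \<longrightarrow> (\<lambda>n. g (size_growth D f n)) \<in> O(g) \<longrightarrow>
        late_prob (tm_comp M F) (D, \<mu>) r \<in> o(g))"
    if "partially_decides M E" and "ptime_computes F (alphabet D) f" for M F p
  proof -
    interpret cs_composition D E \<mu> \<nu> f F M
      using that by unfold_locales
    obtain r where "\<And>n. late_prob (tm_comp M F) (D, \<mu>) r n
        \<le> late_prob M (E, \<nu>) p (size_growth D f n)"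
      using late_prob_comp[OF s] by blast
    from smallo_size_growth[OF this] partially_decides_comp show ?thesis by blast
  qed
  have ratio: "(\<lambda>n. 1 / real (poly q (size_growth D f n))) \<in> O(\<lambda>n. 1 / real (poly q n))" for q
    using strict_mono_imp_increasing[OF strict_mono_size_growth] by (rule bigo_inverse_poly_compose)
  have "GPtime_decides (tm_comp M F) (D, \<mu>)"
    if M: "GPtime_decides M (E, \<nu>)" and F: "ptime_computes F (alphabet D) f" for M F
  proof -
    obtain p where p: "partially_decides M E" "late_prob M (E, \<nu>) p \<in> o(\<lambda>n. 1)"
      using M unfolding GPtime_decides_def fst_conv by blast
    obtain r where "late_prob (tm_comp M F) (D, \<mu>) r \<in> o(\<lambda>n. 1)"
      using comp[OF p(1) F, of p] p(2) landau_o.big_refl[of "\<lambda>_. 1 :: real"] by blast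
    with comp[OF p(1) F] show ?thesis unfolding GPtime_decides_def fst_conv by blast
  qed
  moreover have "SGPtime_decides (tm_comp M F) (D, \<mu>)"
    if M: "SGPtime_decides M (E, \<nu>)" and F: "ptime_computes F (alphabet D) f" for M F
  proof -
    obtain p where p: "partially_decides M E" "late_prob M (E, \<nu>) p \<in> o(\<lambda>n. 1)"
        "\<And>q :: nat poly. q \<noteq> 0 \<Longrightarrow> late_prob M (E, \<nu>) p \<in> o(\<lambda>n. 1 / real (poly q n))"
      using M unfolding SGPtime_decides_def fst_conv by blast
    obtain r where r: "\<And>g. late_prob M (E, \<nu>) p \<in> o(g) \<Longrightarrow>
        (\<lambda>n. g (size_growth D f n)) \<in> O(g) \<Longrightarrow> late_prob (tm_comp M F) (D, \<mu>) r \<in> o(g)"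
      using comp[OF p(1) F, of p] by blast
    have "late_prob (tm_comp M F) (D, \<mu>) r \<in> o(\<lambda>n. 1)"
      using r[OF p(2)] by simp
    moreover have "late_prob (tm_comp M F) (D, \<mu>) r \<in> o(\<lambda>n. 1 / real (poly q n))"
      if "q \<noteq> 0" for q :: "nat poly"
      using r[OF p(3)[OF that] ratio] .
    ultimately have "\<exists>r. late_prob (tm_comp M F) (D, \<mu>) r \<in> o(\<lambda>n. 1) \<and>
        (\<forall>q::nat poly. q \<noteq> 0 \<longrightarrow>
          late_prob (tm_comp M F) (D, \<mu>) r \<in> o(\<lambda>n. 1 / real (poly q n)))"
      by (intro exI[of _ r] conjI allI impI)
    with comp[OF p(1) F, THEN conjunct1] show ?thesis
      unfolding SGPtime_decides_def fst_conv by (rule conjI)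
  qed
  ultimately show ?thesis
    unfolding GPtime_reduction_def SGPtime_reduction_def fst_conv
    using reduction invariant by simp
qed

end
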